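(* Let $\sigma:\Sigma\to\Sigma$ be a transitive one-sided subshift of finite type and let $A\in C^\theta(\hat\Sigma)$ be a $\theta$-Hölder potential. Let $\hat\mu$ be an $A$-maximizing holonomic probability such that $\hat\mu\circ\pi_1^{-1}$ is ergodic (for $\sigma$). Then $\pi_1(\mathrm{supp}(\hat\mu))\subset\Omega(A)$.
   Context: Let $\mathbf M$ be an $r\times r$ matrix with entries in $\{0,1\}$. The one-sided subshift of finite type is $\Sigma=\{\mathbf x=(x_0,x_1,\ldots)\in\{1,\ldots,r\}^{\mathbb N}:\mathbf M(x_j,x_{j+1})=1\ \forall j\ge 0\}$ (nonempty), with the left shift $\sigma(x_0,x_1,\ldots)=(x_1,x_2,\ldots)$. Fix $\lambda\in(0,1)$; $\Sigma$ has the metric $d(\mathbf x,\bar{\mathbf x})=\lambda^{k}$, $k=\min\{j:x_j\ne\bar x_j\}$ (and $d(\mathbf x,\mathbf x)=0$). The dual space is $\Sigma^*=\{\mathbf y=(\ldots,y_1,y_0)\in\{1,\ldots,r\}^{\mathbb N}:\mathbf M(y_{j+1},y_j)=1\ \forall j\ge0\}$, with the analogous metric. Let $\hat\Sigma=\{(\mathbf y,\mathbf x)\in\Sigma^*\times\Sigma:\mathbf M(y_0,x_0)=1\}$, with the maximum metric induced from the product. Define $\tau:\hat\Sigma\to\Sigma$ by $\tau(\mathbf y,\mathbf x)=\tau_{\mathbf y}(\mathbf x)=(y_0,x_0,x_1,\ldots)$, and $\pi_1:\hat\Sigma\to\Sigma$ by $\pi_1(\mathbf y,\mathbf x)=\mathbf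 x$. $C^0(\cdot)$ denotes real-valued continuous functions and $C^\theta(\cdot)$ (with $\theta>0$) the $\theta$-Hölder ones. Transitive means topologically transitive: for all nonempty open $D,E\subset\Sigma$ there is $k\ge1$ with $\sigma^k(D)\cap E\neq\emptyset$. The set $\mathcal M_0$ of holonomic probabilities is the set of Borel probability measures $\hat\mu$ on $\hat\Sigma$ such that $\int f(\tau_{\mathbf y}(\mathbf x))\,d\hat\mu(\mathbf y,\mathbf x)=\int f(\mathbf x)\,d\hat\mu(\mathbf y,\mathbf x)$ for all $f\in C^0(\Sigma)$; for $\hat\mu\in\mathcal M_0$ the measure $\hat\mu\circ\pi_1^{-1}$ on $\Sigma$ is $\sigma$-invariant. For $A\in C^0(\hat\Sigma)$, $\beta_A=\max_{\hat\mu\in\mathcal M_0}\int_{\hat\Sigma}A\,d\hat\mu$; $\hat\mu\in\mathcal M_0$ is $A$-maximizing if $\int A\,d\hat\mu=\beta_A$. For $\epsilon>0$ and $\mathbf x,\bar{\mathbf x}\in\Sigma$, $\mathcal P(\mathbf x,\bar{\mathbf x},\epsilon)$ is the set of finite sequences (paths) $(\mathbf y^0,\mathbf x^0),\ldots,(\mathbf y^{k-1},\mathbf x^{k-1})\in\hat\Sigma$, $k\ge1$, with $\mathbf x^0=\bar{\mathbf x}$, $\mathbf x^{j+1}=\tau_{\mathbf y^j}(\mathbf x^j)$ for $0\le j<k-1$, and $d(\tau_{\mathbf y^{k-1}}(\mathbf x^{k-1}),\mathbf x)<\epsilon$. The set of non-wandering points $\Omega(A)$ consists of those $\mathbf x\in\Sigma$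 such that for every $\epsilon>0$ there is a path in $\mathcal P(\mathbf x,\mathbf x,\epsilon)$ with $|\sum_{j=0}^{k-1}(A-\beta_A)(\mathbf y^j,\mathbf x^j)|<\epsilon$. *)

theory Defs
  imports "HOL-Probability.Probability"
begin

text \<open>
  Symbols are the naturals in \<open>{1..r}\<close>. A point
  \<open>(\<dots>, y\<^sub>1, y\<^sub>0)\<close> of the dual shift is encoded as the function
  \<open>j \<mapsto> y\<^sub>j\<close>, so its index increases to the left.
\<close>

definition shift_space :: "nat \<Rightarrow> (nat \<Rightarrow> nat \<Rightarrow> nat) \<Rightarrow> (nat \<Rightarrow> nat) set" where
  "shift_space r M = {x. \<forall>j. x j \<in> {1..r} \<and> M (x j) (x (Suc j)) = 1}"

definition dual_space :: "nat \<Rightarrow> (nat \<Rightarrow> nat \<Rightarrow> nat) \<Rightarrow> (nat \<Rightarrow> nat) set" where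
  "dual_space r M = {y. \<forall>j. y j \<in> {1..r} \<and> M (y (Suc j)) (y j) = 1}"

definition hat_space ::
    "nat \<Rightarrow> (nat \<Rightarrow> nat \<Rightarrow> nat) \<Rightarrow> ((nat \<Rightarrow> nat) \<times> (nat \<Rightarrow> nat)) set" where
  "hat_space r M = {(y, x). y \<in> dual_space r M \<and> x \<in> shift_space r M \<and> M (y 0) (x 0) = 1}"

definition left_shift :: "(nat \<Rightarrow> nat) \<Rightarrow> (nat \<Rightarrow> nat)" where
  "left_shift x = (\<lambda>j. x (Suc j))"

definition tau :: "(nat \<Rightarrow> nat) \<times> (nat \<Rightarrow> nat) \<Rightarrow> (nat \<Rightarrow> nat)" where
  "tau = (\<lambda>(y, x). case_nat (y 0) x)"

definition seq_dist :: "real \<Rightarrow> (nat \<Rightarrow> nat) \<Rightarrow> (nat \<Rightarrow> nat) \<Rightarrow> real" where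
  "seq_dist lam x x' = (if x = x' then 0 else lam ^ (LEAST j. x j \<noteq> x' j))"

definition hat_dist ::
    "real \<Rightarrow> (nat \<Rightarrow> nat) \<times> (nat \<Rightarrow> nat) \<Rightarrow> (nat \<Rightarrow> nat) \<times> (nat \<Rightarrow> nat) \<Rightarrow> real" where
  "hat_dist lam p q = max (seq_dist lam (fst p) (fst q)) (seq_dist lam (snd p) (snd q))"

definition shift_top :: "nat \<Rightarrow> (nat \<Rightarrow> nat \<Rightarrow> nat) \<Rightarrow> real \<Rightarrow> (nat \<Rightarrow> nat) topology" where
  "shift_top r M lam = Metric_space.mtopology (shift_space r M) (seq_dist lam)"

definition hat_top ::
    "nat \<Rightarrow> (nat \<Rightarrow> nat \<Rightarrow> nat) \<Rightarrow> real \<Rightarrow> ((nat \<Rightarrow> nat) \<times> (nat \<Rightarrow> nat)) topology" where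
  "hat_top r M lam = Metric_space.mtopology (hat_space r M) (hat_dist lam)"

lemma seq_dist_ultrametric:
  assumes "0 < lam" "lam < 1"
  shows "seq_dist lam x z \<le> max (seq_dist lam x y) (seq_dist lam y z)"
proof (cases "x = y \<or> y = z \<or> x = z")
  case True
  then show ?thesis using assms by (auto simp: seq_dist_def le_max_iff_disj)
next
  case False
  define k where "k = (LEAST j. x j \<noteq> z j)"
  from False have "\<exists>j. x j \<noteq> z j" by (auto simp: fun_eq_iff)
  then have "x k \<noteq> z k" unfolding k_def by (rule LeastI_ex)
  then consider "x k \<noteq> y k" | "y k \<noteq> z k" by metis
  then show ?thesis
  proof cases
    case 1
    then have "(LEAST j. x j \<noteq> y j) \<le> k" by (rule Least_le)
    then have "lam ^ k \<le> lam ^ (LEAST j. x j \<noteq> y j)"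
      using assms by (intro power_decreasing) auto
    then show ?thesis using False by (simp add: seq_dist_def k_def)
  next
    case 2
    then have "(LEAST j. y j \<noteq> z j) \<le> k" by (rule Least_le)
    then have "lam ^ k \<le> lam ^ (LEAST j. y j \<noteq> z j)"
      using assms by (intro power_decreasing) auto
    then show ?thesis using False by (simp add: seq_dist_def k_def)
  qed
qed

lemma seq_dist_nonneg: "0 < lam \<Longrightarrow> 0 \<le> seq_dist lam x y"
  by (simp add: seq_dist_def)

lemma seq_dist_eq_0_iff: "0 < lam \<Longrightarrow> seq_dist lam x y = 0 \<longleftrightarrow> x = y"
  by (simp add: seq_dist_def)

lemma seq_dist_commute: "seq_dist lam x y = seq_dist lam y x"
proof -
  have "(\<lambda>j. x j \<noteq> y j) = (\<lambda>j. y j \<noteq> x j)" by auto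
  then show ?thesis by (simp add: seq_dist_def)
qed

lemma Metric_space_seq_dist:
  assumes "0 < lam" "lam < 1"
  shows "Metric_space S (seq_dist lam)"
proof
  fix x y z
  show "seq_dist lam x z \<le> seq_dist lam x y + seq_dist lam y z"
    using seq_dist_ultrametric[OF assms, of x z y] seq_dist_nonneg[OF assms(1), of x y]
      seq_dist_nonneg[OF assms(1), of y z] by linarith
qed (use assms in \<open>auto simp: seq_dist_nonneg seq_dist_eq_0_iff intro: seq_dist_commute\<close>)

lemma Metric_space_hat_dist:
  assumes "0 < lam" "lam < 1"
  shows "Metric_space S (hat_dist lam)"
proof
  fix p q s :: "(nat \<Rightarrow> nat) \<times> (nat \<Rightarrow> nat)"
  note nn = seq_dist_nonneg[OF assms(1)]
  show "0 \<le> hat_dist lam p q"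
    using nn by (simp add: hat_dist_def le_max_iff_disj)
  show "hat_dist lam p q = hat_dist lam q p"
    by (simp add: hat_dist_def seq_dist_commute)
  show "hat_dist lam p q = 0 \<longleftrightarrow> p = q"
    using nn[of "fst p" "fst q"] nn[of "snd p" "snd q"]
      seq_dist_eq_0_iff[OF assms(1), of "fst p" "fst q"]
      seq_dist_eq_0_iff[OF assms(1), of "snd p" "snd q"]
    unfolding hat_dist_def prod_eq_iff by linarith
  show "hat_dist lam p s \<le> hat_dist lam p q + hat_dist lam q s"
    using seq_dist_ultrametric[OF assms, of "fst p" "fst s" "fst q"]
      seq_dist_ultrametric[OF assms, of "snd p" "snd s" "snd q"]
      nn[of "fst p" "fst q"] nn[of "fst q" "fst s"]
      nn[of "snd p" "snd q"] nn[of "snd q" "snd s"]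
    unfolding hat_dist_def by linarith
qed

lemma tau_in_shift_space: "p \<in> hat_space r M \<Longrightarrow> tau p \<in> shift_space r M"
  by (auto simp: hat_space_def dual_space_def shift_space_def tau_def split: nat.split)

definition topologically_transitive ::
    "'a topology \<Rightarrow> ('a \<Rightarrow> 'a) \<Rightarrow> bool" where
  "topologically_transitive T f \<longleftrightarrow>
     (\<forall>D E. openin T D \<and> D \<noteq> {} \<and> openin T E \<and> E \<noteq> {} \<longrightarrow>
        (\<exists>k\<ge>1. (f ^^ k) ` D \<inter> E \<noteq> {}))"

definition holder_on ::
    "real \<Rightarrow> 'a set \<Rightarrow> ('a \<Rightarrow> 'a \<Rightarrow> real) \<Rightarrow> ('a \<Rightarrow> real) \<Rightarrow> bool" where
  "holder_on \<theta> S d f \<longleftrightarrow> (\<exists>C. \<forall>p\<in>S. \<forall>q\<in>S. \<bar>f p - f q\<bar> \<le> C * d p q powr \<theta>)"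

definition borel_of_top :: "'a topology \<Rightarrow> 'a measure" where
  "borel_of_top T = sigma (topspace T) {U. openin T U}"

definition top_support :: "'a topology \<Rightarrow> 'a measure \<Rightarrow> 'a set" where
  "top_support T \<mu> = {p \<in> topspace T. \<forall>U. openin T U \<and> p \<in> U \<longrightarrow> emeasure \<mu> U > 0}"

definition ergodic :: "('a \<Rightarrow> 'a) \<Rightarrow> 'a measure \<Rightarrow> bool" where
  "ergodic f \<nu> \<longleftrightarrow>
     f \<in> measurable \<nu> \<nu> \<and> distr \<nu> \<nu> f = \<nu> \<and>
     (\<forall>B\<in>sets \<nu>. f -` B \<inter> space \<nu> = B \<longrightarrow> measure \<nu> B = 0 \<or> measure \<nu> B = 1)"

definition holonomic ::
    "nat \<Rightarrow> (nat \<Rightarrow> nat \<Rightarrow> nat) \<Rightarrow> real \<Rightarrow> ((nat \<Rightarrow> nat) \<times> (nat \<Rightarrow> nat)) measure set" where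
  "holonomic r M lam =
     {\<mu>. prob_space \<mu> \<and> space \<mu> = hat_space r M \<and>
         sets \<mu> = sets (borel_of_top (hat_top r M lam)) \<and>
         (\<forall>f. continuous_map (shift_top r M lam) euclideanreal f \<longrightarrow>
              (\<integral>p. f (tau p) \<partial>\<mu>) = (\<integral>p. f (snd p) \<partial>\<mu>))}"

text \<open>
  For continuous \<open>A\<close> the map \<open>\<mu> \<mapsto> \<integral>A \<partial>\<mu>\<close> is weak-* continuous on the weak-* compact
  set \<open>holonomic r M lam\<close>; when this set is nonempty the supremum is therefore a maximum.
\<close>

definition beta ::
    "nat \<Rightarrow> (nat \<Rightarrow> nat \<Rightarrow> nat) \<Rightarrow> real \<Rightarrow>
      ((nat \<Rightarrow> nat) \<times> (nat \<Rightarrow> nat) \<Rightarrow> real) \<Rightarrow> real" where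
  "beta r M lam A = (SUP \<mu>\<in>holonomic r M lam. \<integral>p. A p \<partial>\<mu>)"

definition maximizing ::
    "nat \<Rightarrow> (nat \<Rightarrow> nat \<Rightarrow> nat) \<Rightarrow> real \<Rightarrow>
      ((nat \<Rightarrow> nat) \<times> (nat \<Rightarrow> nat) \<Rightarrow> real) \<Rightarrow>
      ((nat \<Rightarrow> nat) \<times> (nat \<Rightarrow> nat)) measure \<Rightarrow> bool" where
  "maximizing r M lam A \<mu> \<longleftrightarrow>
     \<mu> \<in> holonomic r M lam \<and> (\<integral>p. A p \<partial>\<mu>) = beta r M lam A"

definition paths ::
    "nat \<Rightarrow> (nat \<Rightarrow> nat \<Rightarrow> nat) \<Rightarrow> real \<Rightarrow> (nat \<Rightarrow> nat) \<Rightarrow> (nat \<Rightarrow> nat) \<Rightarrow> real \<Rightarrow>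
      ((nat \<Rightarrow> nat) \<times> (nat \<Rightarrow> nat)) list set" where
  "paths r M lam x xbar \<epsilon> =
     {ps. ps \<noteq> [] \<and> set ps \<subseteq> hat_space r M \<and> snd (ps ! 0) = xbar \<and>
          (\<forall>j. Suc j < length ps \<longrightarrow> snd (ps ! Suc j) = tau (ps ! j)) \<and>
          seq_dist lam (tau (last ps)) x < \<epsilon>}"

definition nonwandering ::
    "nat \<Rightarrow> (nat \<Rightarrow> nat \<Rightarrow> nat) \<Rightarrow> real \<Rightarrow>
      ((nat \<Rightarrow> nat) \<times> (nat \<Rightarrow> nat) \<Rightarrow> real) \<Rightarrow> (nat \<Rightarrow> nat) set" where
  "nonwandering r M lam A =
     {x \<in> shift_space r M. \<forall>\<epsilon>>0. \<exists>ps\<in>paths r M lam x x \<epsilon>.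
        \<bar>\<Sum>j<length ps. A (ps ! j) - beta r M lam A\<bar> < \<epsilon>}"

end

theory Submission
  imports Defs
begin

text \<open>
  A path moves from \<open>x\<close> to a preimage of \<open>x\<close> under the shift, so a path of length \<open>n\<close> ending at \<open>z\<close> is
  the orbit segment \<open>z, \<dots>, \<sigma>\<^sup>n z\<close> read backwards, decorated with a choice of pasts. Choosing the
  pasts almost optimally replaces \<open>A\<close> by a potential on the one-sided shift, the
  \<open>edge_potential\<close> \<open>B z = sup {A p | \<tau> p = z}\<close>, and sums along paths by Birkhoff sums \<open>S\<^sub>n\<close> of
  \<open>B - \<beta>\<close>.

  The uniform measure on a decorated periodic orbit is holonomic, so \<open>S\<^sub>n \<le> 0\<close> on periodic orbits
  (\<open>birkhoff_periodic_le_0\<close>). By transitivity every orbit segment can be closed up to a periodic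
  orbit at bounded cost (\<open>bounded_closing\<close>), and the Hoelder condition makes \<open>S\<^sub>n\<close> on the segment and on
  the periodic orbit differ by a bounded amount (\<open>birkhoff_distortion\<close>). Hence all \<open>S\<^sub>n\<close> are bounded
  above, and \<open>gain x = sup {S\<^sub>n z | \<sigma>\<^sup>n z = x}\<close> is a finite, continuous function with
  \<open>gain z + B z - \<beta> \<le> gain (\<sigma> z)\<close>: minus a sub-action.

  Integrating this inequality against a maximizing holonomic measure, the terms in \<open>gain\<close> cancel and
  equality of the integrals results; so the inequality is an equality almost everywhere with respect
  to the projected measure \<open>\<nu>\<close> on the one-sided shift (\<open>maximizing_AE_defect_0\<close>). Along an orbit where
  equality always holds, \<open>S\<^sub>n z\<close> telescopes to \<open>gain (\<sigma>\<^sup>n z) - gain z\<close>, which is small as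
  soon as both ends are near one another.

  If \<open>x\<close> is the projection of a point of the support, every cylinder around \<open>x\<close> has positive
  \<open>\<nu>\<close>-measure. As \<open>\<nu>\<close> is invariant, Poincare recurrence supplies such an orbit that starts in the
  cylinder and returns to it (\<open>ex_returning_orbit\<close>). Keeping its first \<open>n\<close> symbols and continuing with
  those of \<open>x\<close> changes \<open>S\<^sub>n\<close> only slightly and gives an orbit segment that ends exactly at \<open>x\<close>; read
  backwards, it is the required path (\<open>support_subset_nonwandering\<close>).
\<close>

section \<open>Recurrence and Borel structures\<close>

lemma funpow_measurable:
  assumes "f \<in> measurable M M"
  shows "(f ^^ n) \<in> measurable M M"
  using assms by (induction n) (auto intro: measurable_comp simp: id_def)

lemma distr_funpow:
  assumes f: "f \<in> measurable M M" and inv: "distr M M f = M"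
  shows "distr M M (f ^^ n) = M"
proof (induction n)
  case 0
  then show ?case by (simp add: id_def distr_id)
next
  case (Suc n)
  have "distr M M (f ^^ Suc n) = distr (distr M M (f ^^ n)) M f"
    by (simp add: distr_distr f funpow_measurable)
  then show ?case using Suc inv by metis
qed

text \<open>
  Poincare recurrence: the sets of points whose last visit to \<open>U\<close> happens at time \<open>j\<close>
  are pairwise disjoint and, by invariance, all of the same measure, which a finite
  measure allows only if that measure is zero.
\<close>

lemma (in finite_measure) AE_returns:
  assumes f: "f \<in> measurable M M" and inv: "distr M M f = M" and U: "U \<in> sets M"
  shows "AE x in M. x \<in> U \<longrightarrow> (\<exists>n\<ge>1. (f ^^ n) x \<in> U)"
proof -
  define V where "V = {x \<in> space M. x \<in> U \<and> (\<forall>n\<ge>1. (f ^^ n) x \<notin> U)}"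
  define W where "W j = (f ^^ j) -` V \<inter> space M" for j
  note fn [measurable] = funpow_measurable[OF f]
  note U [measurable]
  have V [measurable]: "V \<in> sets M"
    unfolding V_def by measurable
  have Wm: "measure M (W j) = measure M V" for j
    using measure_distr[OF fn[of j] V] distr_funpow[OF f inv, of j] by (simp add: W_def)
  have "W i \<inter> W j = {}" if "i < j" for i j
  proof -
    have "(f ^^ (j - i)) ((f ^^ i) x) = (f ^^ j) x" for x
      using that by (simp flip: comp_apply[of "f ^^ (j - i)"] funpow_add)
    moreover have "1 \<le> j - i" using that by simp
    ultimately have "(f ^^ j) x \<notin> U" if "x \<in> W i" for x
      using that by (metis (mono_tags, lifting) IntD1 V_def W_def mem_Collect_eq vimageE)
    then show ?thesis by (auto simp: W_def V_def)
  qed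
  then have "disjoint_family W"
    unfolding disjoint_family_on_def by (metis Int_commute linorder_neqE_nat)
  moreover have "range W \<subseteq> sets M" by (auto simp: W_def)
  ultimately have "(\<lambda>j. measure M (W j)) sums measure M (\<Union>j. W j)"
    by (intro finite_measure_UNION)
  then have "summable (\<lambda>j::nat. measure M V)"
    by (simp add: Wm sums_iff)
  then have "V \<in> null_sets M"
    by (simp add: summable_const_iff null_sets_def emeasure_eq_measure V)
  then have "AE x in M. x \<notin> V" by (rule AE_not_in)
  with AE_space show ?thesis
    by eventually_elim (auto simp: V_def)
qed

lemma space_borel_of_top: "space (borel_of_top T) = topspace T"
  and sets_borel_of_top: "sets (borel_of_top T) = sigma_sets (topspace T) {U. openin T U}"
  by (auto simp: borel_of_top_def intro!: space_measure_of sets_measure_of dest!: openin_subset)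

lemma openin_in_borel_of_top: "openin T U \<Longrightarrow> U \<in> sets (borel_of_top T)"
  by (simp add: sets_borel_of_top)

lemma continuous_map_borel_of_top:
  assumes "continuous_map T T' f"
  shows "f \<in> measurable (borel_of_top T) (borel_of_top T')"
  unfolding borel_of_top_def[of T']
proof (rule measurable_measure_of)
  show "{U. openin T' U} \<subseteq> Pow (topspace T')" by (auto dest: openin_subset)
  show "f \<in> space (borel_of_top T) \<rightarrow> topspace T'"
    using continuous_map_funspace[OF assms] by (simp add: space_borel_of_top)
  fix U assume "U \<in> {U. openin T' U}"
  then have "openin T {x \<in> topspace T. f x \<in> U}"
    using assms by (simp add: openin_continuous_map_preimage)
  moreover have "f -` U \<inter> topspace T = {x \<in> topspace T. f x \<in> U}" by auto
  ultimately show "f -` U \<inter> space (borel_of_top T) \<in> sets (borel_of_top T)"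
    by (simp add: openin_in_borel_of_top space_borel_of_top)
qed

lemma continuous_map_real_borel_of_top:
  assumes "continuous_map T euclideanreal f"
  shows "f \<in> borel_measurable (borel_of_top T)"
  using continuous_map_borel_of_top[OF assms] by (simp add: borel_of_top_def borel_def)

section \<open>Words and cylinders\<close>

definition agree :: "nat \<Rightarrow> (nat \<Rightarrow> nat) \<Rightarrow> (nat \<Rightarrow> nat) \<Rightarrow> bool" where
  "agree n x y \<longleftrightarrow> (\<forall>i<n. x i = y i)"

definition splice :: "nat \<Rightarrow> (nat \<Rightarrow> nat) \<Rightarrow> (nat \<Rightarrow> nat) \<Rightarrow> (nat \<Rightarrow> nat)" where
  "splice n z t = (\<lambda>i. if i < n then z i else t (i - n))"

lemma funpow_left_shift: "(left_shift ^^ n) x = (\<lambda>i. x (i + n))"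
  by (induction n) (auto simp: left_shift_def fun_eq_iff)

lemma left_shift_splice: "(left_shift ^^ n) (splice n z t) = t"
  by (simp add: funpow_left_shift splice_def)

lemma agree_sym: "agree n x y \<Longrightarrow> agree n y x"
  by (simp add: agree_def)

lemma agree_trans: "agree n x y \<Longrightarrow> agree n y z \<Longrightarrow> agree n x z"
  by (simp add: agree_def)

lemma agree_mono: "agree n x y \<Longrightarrow> m \<le> n \<Longrightarrow> agree m x y"
  by (simp add: agree_def)

lemma agree_funpow_left_shift:
  "agree (n + j) x y \<Longrightarrow> agree n ((left_shift ^^ j) x) ((left_shift ^^ j) y)"
  by (simp add: agree_def funpow_left_shift)

text \<open>
  If \<open>x\<close> shadows the orbit of \<open>z\<close> from time \<open>n\<close> on for \<open>N\<close> steps, then replacing the tail of \<open>z\<close> by \<open>x\<close>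
  is a change only from position \<open>n + N\<close> on. This is how an orbit that passes near \<open>x\<close> is
  made to pass through \<open>x\<close>.
\<close>

lemma agree_splice:
  assumes "agree N ((left_shift ^^ n) z) x"
  shows "agree (n + N) z (splice n z x)"
  unfolding agree_def
proof (intro allI impI)
  fix i assume "i < n + N"
  then show "z i = splice n z x i"
    using assms
    by (cases "i < n") (auto simp: agree_def splice_def funpow_left_shift dest!: spec[of _ "i - n"])
qed

lemma seq_dist_le_if_agree:
  assumes "0 < lam" "lam < 1" "agree n x y"
  shows "seq_dist lam x y \<le> lam ^ n"
proof (cases "x = y")
  case False
  have "x (LEAST j. x j \<noteq> y j) \<noteq> y (LEAST j. x j \<noteq> y j)"
    by (rule LeastI_ex[of "\<lambda>j. x j \<noteq> y j"]) (use False in \<open>auto simp: fun_eq_iff\<close>)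
  then have "n \<le> (LEAST j. x j \<noteq> y j)"
    using assms(3) by (meson agree_def not_le)
  then show ?thesis
    using assms False by (simp add: seq_dist_def power_decreasing)
qed (use assms in \<open>simp add: seq_dist_def\<close>)

lemma agree_if_seq_dist_less:
  assumes "0 < lam" "lam < 1" "seq_dist lam x y < lam ^ n"
  shows "agree (Suc n) x y"
  unfolding agree_def
proof (intro allI impI, rule ccontr)
  fix i assume "i < Suc n" and i: "x i \<noteq> y i"
  then have "(LEAST j. x j \<noteq> y j) \<le> n"
    using Least_le[of "\<lambda>j. x j \<noteq> y j" i] by simp
  then have "lam ^ n \<le> lam ^ (LEAST j. x j \<noteq> y j)"
    using assms by (intro power_decreasing) auto
  then show False using assms i by (auto simp: seq_dist_def split: if_splits)
qed

lemma shift_space_funpow: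
  "x \<in> shift_space r M \<Longrightarrow> (left_shift ^^ n) x \<in> shift_space r M"
  by (auto simp: shift_space_def funpow_left_shift)

lemma shift_space_left_shift:
  "x \<in> shift_space r M \<Longrightarrow> left_shift x \<in> shift_space r M"
  by (auto simp: shift_space_def left_shift_def)

lemma splice_in_shift_space:
  assumes "z \<in> shift_space r M" "t \<in> shift_space r M" "z n = t 0"
  shows "splice n z t \<in> shift_space r M"
proof -
  have "M (splice n z t j) (splice n z t (Suc j)) = 1" for j
  proof -
    consider "Suc j < n" | "Suc j = n" | "n \<le> j" by linarith
    then show ?thesis
    proof cases
      case 2
      moreover have "M (z j) (z (Suc j)) = 1" using assms(1) by (simp add: shift_space_def)
      ultimately show ?thesis using assms(3) by (auto simp: splice_def)
    qed (use assms in \<open>simp_all add: shift_space_def splice_def Suc_diff_le\<close>)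
  qed
  then show ?thesis using assms by (auto simp: shift_space_def splice_def)
qed

lemma periodic_in_shift_space:
  assumes "w \<in> shift_space r M" "1 \<le> m" "w m = w 0"
  shows "(\<lambda>i. w (i mod m)) \<in> shift_space r M"
proof -
  have "M (w (i mod m)) (w (Suc i mod m)) = 1" for i
  proof (cases "Suc (i mod m) = m")
    case True
    have "M (w (i mod m)) (w (Suc (i mod m))) = 1" using assms by (auto simp: shift_space_def)
    then show ?thesis using True assms by (simp add: mod_Suc)
  next
    case False
    then show ?thesis using assms by (simp add: mod_Suc shift_space_def)
  qed
  then show ?thesis using assms by (auto simp: shift_space_def)
qed

locale markov_shift =
  fixes r :: nat and M :: "nat \<Rightarrow> nat \<Rightarrow> nat" and lam :: real
  assumes lam_pos: "0 < lam" and lam_less_1: "lam < 1"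
begin

abbreviation "\<Sigma> \<equiv> shift_space r M"
abbreviation "\<Sigma>h \<equiv> hat_space r M"

lemmas seq_metric = Metric_space_seq_dist[OF lam_pos lam_less_1]
lemmas hat_metric = Metric_space_hat_dist[OF lam_pos lam_less_1]

lemma topspace_hat_top: "topspace (hat_top r M lam) = \<Sigma>h"
  by (simp add: hat_top_def Metric_space.topspace_mtopology[OF hat_metric])

lemma openin_cylinder: "openin (shift_top r M lam) {z \<in> \<Sigma>. agree n x z}"
  unfolding shift_top_def Metric_space.openin_mtopology[OF seq_metric]
proof (intro conjI allI impI)
  fix z assume z: "z \<in> {z \<in> \<Sigma>. agree n x z}"
  have "agree n x w" if "seq_dist lam z w < lam ^ n" for w
    using agree_if_seq_dist_less[OF lam_pos lam_less_1 that] z by (simp add: agree_def)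
  then have "Metric_space.mball \<Sigma> (seq_dist lam) z (lam ^ n) \<subseteq> {z \<in> \<Sigma>. agree n x z}"
    by (auto simp: Metric_space.in_mball[OF seq_metric])
  then show "\<exists>s>0. Metric_space.mball \<Sigma> (seq_dist lam) z s \<subseteq> {z \<in> \<Sigma>. agree n x z}"
    using lam_pos by (intro exI[of _ "lam ^ n"]) simp
qed auto

lemma snd_in_shift_space: "p \<in> \<Sigma>h \<Longrightarrow> snd p \<in> \<Sigma>"
  by (auto simp: hat_space_def)

lemma left_shift_tau: "left_shift (tau p) = snd p"
  by (auto simp: left_shift_def tau_def split: prod.splits)

lemma continuous_map_snd: "continuous_map (hat_top r M lam) (shift_top r M lam) snd"
  unfolding hat_top_def shift_top_def Metric_space.metric_continuous_map[OF hat_metric seq_metric]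
  by (auto simp: hat_dist_def intro!: snd_in_shift_space)

text \<open>
  Agreement of the pasts in their symbol of index \<open>0\<close> makes the new first symbols equal, and the other
  symbols are those of the second component.
\<close>

lemma continuous_map_tau: "continuous_map (hat_top r M lam) (shift_top r M lam) tau"
proof -
  have "seq_dist lam (tau p) (tau q) \<le> lam ^ n" if "hat_dist lam p q < lam ^ n" for p q n
  proof (rule seq_dist_le_if_agree[OF lam_pos lam_less_1])
    have "agree (Suc n) (fst p) (fst q)" "agree (Suc n) (snd p) (snd q)"
      using that by (auto intro!: agree_if_seq_dist_less[OF lam_pos lam_less_1] simp: hat_dist_def)
    then show "agree n (tau p) (tau q)"
      by (auto simp: agree_def tau_def split: prod.splits nat.splits)
  qed
  moreover have "\<exists>n. lam ^ n < e" if "e > 0" for e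
    using that lam_less_1 by (rule real_arch_pow_inv)
  ultimately have "\<exists>\<delta>>0. \<forall>q. hat_dist lam p q < \<delta> \<longrightarrow> seq_dist lam (tau p) (tau q) < e"
    if "e > 0" for e p
    using that lam_pos by (meson le_less_trans zero_less_power)
  then show ?thesis
    unfolding hat_top_def shift_top_def Metric_space.metric_continuous_map[OF hat_metric seq_metric]
    by (auto intro: tau_in_shift_space) blast
qed

text \<open>
  The offset \<open>a\<close> accommodates functions such as \<open>f \<circ> left_shift\<close>, which lose a symbol, and functions that are
  controlled only between points with the same first symbol.
\<close>

lemma continuous_map_if_variation:
  assumes "0 \<le> \<rho>" "\<rho> < 1"
    and var: "\<And>n x x'. x \<in> \<Sigma> \<Longrightarrow> x' \<in> \<Sigma> \<Longrightarrow> agree (n + a) x x' \<Longrightarrow> \<bar>f x - f x'\<bar> \<le> D * \<rho> ^ n"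
  shows "continuous_map (shift_top r M lam) euclideanreal f"
proof -
  have "\<exists>\<delta>>0. \<forall>x'. x' \<in> \<Sigma> \<and> seq_dist lam x x' < \<delta> \<longrightarrow> dist (f x) (f x') < e"
    if "e > 0" "x \<in> \<Sigma>" for e x
  proof -
    have "(\<lambda>n. D * \<rho> ^ n) \<longlonglongrightarrow> D * 0"
      using assms by (intro tendsto_mult_left LIMSEQ_realpow_zero) auto
    then have "\<forall>\<^sub>F n in sequentially. D * \<rho> ^ n < e"
      using \<open>e > 0\<close> by (intro order_tendstoD) auto
    then obtain n where n: "D * \<rho> ^ n < e"
      by (auto simp: eventually_sequentially)
    show ?thesis
    proof (intro exI[of _ "lam ^ (n + a)"] conjI allI impI)
      fix x' assume x': "x' \<in> \<Sigma> \<and> seq_dist lam x x' < lam ^ (n + a)"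
      then have "agree (n + a) x x'"
        using agree_if_seq_dist_less[OF lam_pos lam_less_1] agree_mono by (meson le_SucI order_refl)
      with var[of x x' n] x' \<open>x \<in> \<Sigma>\<close> n show "dist (f x) (f x') < e"
        by (simp add: dist_real_def)
    qed (use lam_pos in simp)
  qed
  then show ?thesis
    unfolding shift_top_def mtopology_is_euclidean[symmetric]
      Metric_space.metric_continuous_map[OF seq_metric Met_TC.Metric_space_axioms]
    by auto
qed

end

section \<open>The edge potential and its Birkhoff sums\<close>

locale holder_potential = markov_shift r M lam
  for r :: nat and M :: "nat \<Rightarrow> nat \<Rightarrow> nat" and lam :: real +
  fixes A :: "(nat \<Rightarrow> nat) \<times> (nat \<Rightarrow> nat) \<Rightarrow> real" and \<theta> C :: real
  assumes transitive: "topologically_transitive (shift_top r M lam) left_shift"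
    and \<theta>_pos: "0 < \<theta>"
    and C_nonneg: "0 \<le> C"
    and holder: "\<And>p q. p \<in> hat_space r M \<Longrightarrow> q \<in> hat_space r M \<Longrightarrow>
      \<bar>A p - A q\<bar> \<le> C * hat_dist lam p q powr \<theta>"
begin

text \<open>
  Contraction rate of the potential: points that agree on \<open>n\<close> symbols have distance at most \<open>lam ^ n\<close>, and
  the Hoelder exponent turns this into \<open>\<rho> ^ n\<close>.
\<close>

definition \<rho> :: real where "\<rho> = lam powr \<theta>"

lemma \<rho>_pos: "0 < \<rho>" and \<rho>_less_1: "\<rho> < 1"
  using lam_pos lam_less_1 \<theta>_pos powr_less_mono2[of \<theta> lam 1] by (auto simp: \<rho>_def)

lemma A_variation:
  assumes "p \<in> \<Sigma>h" "q \<in> \<Sigma>h" "agree n (fst p) (fst q)" "agree n (snd p) (snd q)"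
  shows "\<bar>A p - A q\<bar> \<le> C * \<rho> ^ n"
proof -
  have "hat_dist lam p q \<le> lam ^ n"
    using assms by (simp add: hat_dist_def seq_dist_le_if_agree[OF lam_pos lam_less_1])
  then have "hat_dist lam p q powr \<theta> \<le> (lam ^ n) powr \<theta>"
    using \<theta>_pos Metric_space.nonneg[OF hat_metric] by (intro powr_mono2) auto
  also have "\<dots> = \<rho> ^ n"
    using lam_pos by (simp add: \<rho>_def powr_power powr_powr mult.commute flip: powr_realpow)
  finally have "C * hat_dist lam p q powr \<theta> \<le> C * \<rho> ^ n"
    using C_nonneg by (rule mult_left_mono)
  with holder[OF assms(1,2)] show ?thesis by linarith
qed

lemma A_bounded: "\<exists>K\<ge>0. \<forall>p\<in>\<Sigma>h. \<bar>A p\<bar> \<le> K"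
proof (cases "\<Sigma>h = {}")
  case False
  then obtain q where q: "q \<in> \<Sigma>h" by auto
  have "\<bar>A p\<bar> \<le> \<bar>A q\<bar> + C" if "p \<in> \<Sigma>h" for p
    using A_variation[OF that q, of 0] by (auto simp: agree_def)
  then show ?thesis using C_nonneg by (intro exI[of _ "\<bar>A q\<bar> + C"]) auto
qed auto

lemma continuous_map_A: "continuous_map (hat_top r M lam) euclideanreal A"
proof -
  have "\<exists>\<delta>>0. \<forall>q. q \<in> \<Sigma>h \<and> hat_dist lam p q < \<delta> \<longrightarrow> dist (A p) (A q) < e"
    if "e > 0" "p \<in> \<Sigma>h" for e p
  proof -
    have "(\<lambda>n. C * \<rho> ^ n) \<longlonglongrightarrow> C * 0"
      using \<rho>_pos \<rho>_less_1 by (intro tendsto_mult_left LIMSEQ_realpow_zero) auto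
    then have "\<forall>\<^sub>F n in sequentially. C * \<rho> ^ n < e"
      using \<open>e > 0\<close> by (intro order_tendstoD) auto
    then obtain n where n: "C * \<rho> ^ n < e"
      by (auto simp: eventually_sequentially)
    show ?thesis
    proof (intro exI[of _ "lam ^ n"] conjI allI impI)
      fix q assume q: "q \<in> \<Sigma>h \<and> hat_dist lam p q < lam ^ n"
      then have "agree n (fst p) (fst q)" "agree n (snd p) (snd q)"
        using agree_mono[OF agree_if_seq_dist_less[OF lam_pos lam_less_1]]
        by (auto simp: hat_dist_def)
      with A_variation[of p q n] q \<open>p \<in> \<Sigma>h\<close> n show "dist (A p) (A q) < e"
        by (simp add: dist_real_def)
    qed (use lam_pos in simp)
  qed
  then show ?thesis
    unfolding hat_top_def mtopology_is_euclidean[symmetric]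
      Metric_space.metric_continuous_map[OF hat_metric Met_TC.Metric_space_axioms]
    by auto
qed

text \<open>
  Transitivity, applied to two cylinders of length one, provides a word from the last symbol of the
  prefix of \<open>z\<close> back to its first symbol; repeating prefix and word periodically gives \<open>q\<close>. There are
  finitely many pairs of symbols, whence the bound \<open>L\<close> that is uniform in \<open>z\<close> and \<open>n\<close>.
\<close>

lemma bounded_closing:
  "\<exists>L. \<forall>z\<in>\<Sigma>. \<forall>n\<ge>1. \<exists>m q. n \<le> m \<and> m \<le> n + L \<and> q \<in> \<Sigma> \<and> (left_shift ^^ m) q = q \<and> agree n q z"
proof -
  define P where "P a b k \<longleftrightarrow> 1 \<le> k \<and> (\<exists>t\<in>\<Sigma>. t 0 = a \<and> t k = b)" for a b k
  define k where "k a b = (SOME k. P a b k)" for a b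
  have conn: "P a b (k a b)" if "\<exists>x\<in>\<Sigma>. x 0 = a" "\<exists>x\<in>\<Sigma>. x 0 = b" for a b
  proof -
    from that obtain x x' where x: "x \<in> \<Sigma>" "x 0 = a" "x' \<in> \<Sigma>" "x' 0 = b" by auto
    have "x \<in> {z \<in> \<Sigma>. agree 1 x z}" "x' \<in> {z \<in> \<Sigma>. agree 1 x' z}"
      using x by (auto simp: agree_def)
    then have "\<exists>j\<ge>1. (left_shift ^^ j) ` {z \<in> \<Sigma>. agree 1 x z} \<inter> {z \<in> \<Sigma>. agree 1 x' z} \<noteq> {}"
      by (intro transitive[unfolded topologically_transitive_def, rule_format] conjI openin_cylinder) auto
    then obtain j t where "1 \<le> j" "t \<in> \<Sigma>" "agree 1 x t" "agree 1 x' ((left_shift ^^ j) t)"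
      by auto
    then have "P a b j"
      using x by (auto simp: P_def agree_def funpow_left_shift)
    then show ?thesis unfolding k_def by (rule someI)
  qed
  \<comment> \<open>The sum over all pairs of symbols serves as a common upper bound; a pair
    with a symbol that occurs in no sequence contributes an arbitrary value.\<close>
  define L where "L = (\<Sum>(a, b)\<in>{1..r} \<times> {1..r}. k a b)"
  have kL: "k a b \<le> L" if "a \<in> {1..r}" "b \<in> {1..r}" for a b
    using member_le_sum[of "(a, b)" "{1..r} \<times> {1..r}" "\<lambda>(a, b). k a b"] that by (simp add: L_def)
  have "\<exists>m q. n \<le> m \<and> m \<le> n + L \<and> q \<in> \<Sigma> \<and> (left_shift ^^ m) q = q \<and> agree n q z"
    if z: "z \<in> \<Sigma>" and n: "1 \<le> n" for z n
  proof -
    \<comment> \<open>The connecting word starts with the last symbol of the prefix, so the two overlap in one place.\<close>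
    define j where "j = k (z (n - 1)) (z 0)"
    have "(left_shift ^^ (n - 1)) z \<in> \<Sigma>" "(left_shift ^^ (n - 1)) z 0 = z (n - 1)"
      using z shift_space_funpow by (auto simp: funpow_left_shift)
    then have "\<exists>x\<in>\<Sigma>. x 0 = z (n - 1)" by (intro bexI[of _ "(left_shift ^^ (n - 1)) z"])
    moreover have "\<exists>x\<in>\<Sigma>. x 0 = z 0" using z by (rule bexI[rotated]) simp
    ultimately have "P (z (n - 1)) (z 0) j"
      unfolding j_def by (rule conn)
    then obtain t where j: "1 \<le> j" and t: "t \<in> \<Sigma>" "t 0 = z (n - 1)" "t j = z 0"
      by (auto simp: P_def)
    define w where "w = splice (n - 1) z t"
    have w: "w \<in> \<Sigma>" using splice_in_shift_space[OF z t(1)] t(2) by (simp add: w_def)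
    define m where "m = n - 1 + j"
    have m: "n \<le> m" "m \<le> n + L" "1 \<le> m"
      using n j kL[of "z (n - 1)" "z 0"] z by (auto simp: m_def j_def shift_space_def)
    have "w m = w 0"
      using t by (auto simp: w_def splice_def m_def)
    with w m have "(\<lambda>i. w (i mod m)) \<in> \<Sigma>" by (intro periodic_in_shift_space)
    moreover have "(left_shift ^^ m) (\<lambda>i. w (i mod m)) = (\<lambda>i. w (i mod m))"
      by (simp add: funpow_left_shift)
    moreover have "agree n (\<lambda>i. w (i mod m)) z"
      unfolding agree_def
    proof (intro allI impI)
      fix i assume "i < n"
      then have "i mod m = i" "i < n - 1 \<or> i = n - 1" using m by auto
      then show "w (i mod m) = z i" using t by (auto simp: w_def splice_def)
    qed
    ultimately show ?thesis using m by blast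
  qed
  then show ?thesis by blast
qed

text \<open>
  Every symbol that occurs has an infinite past: it lies on a periodic word, which can be run through
  backwards.
\<close>

lemma ex_past:
  assumes "z \<in> \<Sigma>"
  shows "\<exists>y\<in>dual_space r M. y 0 = z 0"
proof -
  obtain m q where m: "1 \<le> m" and q: "q \<in> \<Sigma>" "(left_shift ^^ m) q = q" "agree 1 q z"
    using bounded_closing assms by (metis order_refl)
  have per: "q (i + m) = q i" for i
    using fun_cong[OF q(2), of i] by (simp add: funpow_left_shift)
  \<comment> \<open>Modulo the period \<open>m\<close>, the index \<open>(m - 1) * j\<close> is \<open>- j\<close>.\<close>
  define y where "y j = q ((m - 1) * j)" for j
  have "M (y (Suc j)) (y j) = 1" for j
  proof -
    have "Suc ((m - 1) * Suc j) = (m - 1) * j + m" using m by simp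
    then have "q (Suc ((m - 1) * Suc j)) = y j"
      by (simp only: per y_def)
    moreover have "M (q ((m - 1) * Suc j)) (q (Suc ((m - 1) * Suc j))) = 1"
      using q(1) by (simp only: shift_space_def mem_Collect_eq)
    ultimately show ?thesis by (simp only: y_def)
  qed
  then have "y \<in> dual_space r M"
    using q(1) by (auto simp: dual_space_def shift_space_def y_def)
  moreover have "y 0 = z 0" using q(3) by (simp add: y_def agree_def)
  ultimately show ?thesis by blast
qed

text \<open>
  The best value of \<open>A\<close> on a step that arrives at \<open>z\<close>. Such a step starts at \<open>left_shift z\<close>, and only the part of
  its past beyond the symbol \<open>z 0\<close> is free.
\<close>

definition edge_potential :: "(nat \<Rightarrow> nat) \<Rightarrow> real" where
  "edge_potential z = (SUP p\<in>{p \<in> \<Sigma>h. tau p = z}. A p)"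

lemma tau_eq_iff: "p \<in> \<Sigma>h \<Longrightarrow> tau p = z \<longleftrightarrow> fst p 0 = z 0 \<and> snd p = left_shift z"
  by (force simp: tau_def left_shift_def fun_eq_iff split: prod.splits nat.split)

lemma fibre_memI:
  assumes "y \<in> dual_space r M" "z \<in> \<Sigma>" "y 0 = z 0"
  shows "(y, left_shift z) \<in> \<Sigma>h" "tau (y, left_shift z) = z"
proof -
  show "(y, left_shift z) \<in> \<Sigma>h"
    using assms by (auto simp: hat_space_def shift_space_left_shift) (auto simp: shift_space_def left_shift_def)
  then show "tau (y, left_shift z) = z" using assms by (simp add: tau_eq_iff)
qed

lemma fibre_nonempty:
  assumes "z \<in> \<Sigma>"
  shows "{p \<in> \<Sigma>h. tau p = z} \<noteq> {}"
proof -
  obtain y where "y \<in> dual_space r M" "y 0 = z 0" using ex_past[OF assms] by auto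
  then have "(y, left_shift z) \<in> {p \<in> \<Sigma>h. tau p = z}"
    using fibre_memI[of y z] assms by simp
  then show ?thesis by (metis empty_iff)
qed

lemma bdd_above_A:
  assumes "P \<subseteq> \<Sigma>h"
  shows "bdd_above (A ` P)"
proof -
  obtain K where "\<forall>p\<in>\<Sigma>h. \<bar>A p\<bar> \<le> K" using A_bounded by blast
  then show ?thesis using assms by (intro bdd_aboveI2[of _ _ K]) (auto dest: abs_le_D1)
qed

lemma bdd_above_fibre: "bdd_above (A ` {p \<in> \<Sigma>h. tau p = z})"
  by (rule bdd_above_A) simp

lemma A_le_edge_potential: "p \<in> \<Sigma>h \<Longrightarrow> A p \<le> edge_potential (tau p)"
  unfolding edge_potential_def by (rule cSUP_upper[OF _ bdd_above_fibre]) simp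

lemma edge_potential_approx:
  assumes "z \<in> \<Sigma>" "\<delta> > 0"
  shows "\<exists>p\<in>\<Sigma>h. tau p = z \<and> snd p = left_shift z \<and> edge_potential z - \<delta> < A p"
proof -
  have "edge_potential z - \<delta> < (SUP p\<in>{p \<in> \<Sigma>h. tau p = z}. A p)" using assms by (simp add: edge_potential_def)
  then obtain p where p: "p \<in> {p \<in> \<Sigma>h. tau p = z}" "edge_potential z - \<delta> < A p"
    unfolding less_cSUP_iff[OF fibre_nonempty[OF assms(1)] bdd_above_fibre] ..
  moreover from p have "snd p = left_shift z" using left_shift_tau[of p] by simp
  ultimately show ?thesis by (intro bexI[of _ p]) simp_all
qed

text \<open>
  Near-optimal pasts are enough throughout, so that no maximizer in a fibre has to be chosen.
\<close>

lemma orbit_lift: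
  assumes "z \<in> \<Sigma>" "\<delta> > 0"
  shows "\<exists>p. \<forall>j. p j \<in> \<Sigma>h \<and> tau (p j) = (left_shift ^^ j) z \<and>
    snd (p j) = (left_shift ^^ Suc j) z \<and> edge_potential ((left_shift ^^ j) z) - \<delta> < A (p j)"
proof (rule choice, rule allI)
  fix j
  show "\<exists>p. p \<in> \<Sigma>h \<and> tau p = (left_shift ^^ j) z \<and>
      snd p = (left_shift ^^ Suc j) z \<and> edge_potential ((left_shift ^^ j) z) - \<delta> < A p"
    using edge_potential_approx[OF shift_space_funpow[OF assms(1), of j] assms(2)] unfolding funpow.simps comp_apply by blast
qed

text \<open>
  If \<open>z\<close> and \<open>z'\<close> have the same first symbol, the same pasts are admissible for both, and a past used
  for one competes for the other. The first symbol enters only through this set of pasts, so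
  agreement on \<open>Suc n\<close> symbols counts as agreement of the shifted points on \<open>n\<close>.
\<close>

lemma edge_potential_variation:
  assumes "z \<in> \<Sigma>" "z' \<in> \<Sigma>" "agree (Suc n) z z'"
  shows "\<bar>edge_potential z - edge_potential z'\<bar> \<le> C * \<rho> ^ n"
proof -
  have "edge_potential z \<le> edge_potential z' + C * \<rho> ^ n"
    if z: "z \<in> \<Sigma>" "z' \<in> \<Sigma>" "agree (Suc n) z z'" for z z'
    unfolding edge_potential_def[of z]
  proof (rule cSUP_least[OF fibre_nonempty[OF z(1)]])
    fix p assume "p \<in> {p \<in> \<Sigma>h. tau p = z}"
    then have p: "p \<in> \<Sigma>h" "fst p 0 = z 0" "snd p = left_shift z" using tau_eq_iff[of p z] by auto
    define q where "q = (fst p, left_shift z')"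
    have "fst p \<in> dual_space r M" "fst p 0 = z' 0"
      using p z(3) by (auto simp: hat_space_def agree_def)
    then have q: "q \<in> \<Sigma>h" "tau q = z'" using fibre_memI z(2) by (auto simp: q_def)
    have "\<bar>A p - A q\<bar> \<le> C * \<rho> ^ n"
      using p q z(3) by (intro A_variation) (auto simp: q_def agree_def left_shift_def)
    moreover have "A q \<le> edge_potential z'" using A_le_edge_potential[OF q(1)] q(2) by simp
    ultimately show "A p \<le> edge_potential z' + C * \<rho> ^ n" by linarith
  qed
  from this[OF assms] this[OF assms(2,1) agree_sym[OF assms(3)]] show ?thesis by linarith
qed

lemma edge_potential_bounded: "\<exists>K\<ge>0. \<forall>z\<in>\<Sigma>. \<bar>edge_potential z\<bar> \<le> K"
proof -
  obtain K where K: "0 \<le> K" "\<And>p. p \<in> \<Sigma>h \<Longrightarrow> \<bar>A p\<bar> \<le> K" using A_bounded by auto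
  have "\<bar>edge_potential z\<bar> \<le> K" if z: "z \<in> \<Sigma>" for z
  proof -
    have "edge_potential z \<le> K"
      unfolding edge_potential_def using K by (intro cSUP_least fibre_nonempty[OF z]) (auto dest: abs_le_D1)
    moreover obtain p where "p \<in> \<Sigma>h" "tau p = z" using fibre_nonempty[OF z] by auto
    ultimately show ?thesis using A_le_edge_potential[of p] K(2)[of p] by (simp add: abs_le_iff)
  qed
  with K show ?thesis by auto
qed

abbreviation \<beta> :: real where "\<beta> \<equiv> beta r M lam A"

text \<open>
  The supremum, over all choices of pasts, of the sum of \<open>A - \<beta>\<close> along a path from \<open>(left_shift ^^ n) z\<close>
  to \<open>z\<close>.
\<close>

definition birkhoff :: "nat \<Rightarrow> (nat \<Rightarrow> nat) \<Rightarrow> real" where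
  "birkhoff n z = (\<Sum>j<n. edge_potential ((left_shift ^^ j) z) - \<beta>)"

text \<open>
  The geometric series of the variations of the potential along two orbits that approach each other.
\<close>

definition distortion :: real where "distortion = C / (1 - \<rho>)"

lemma distortion_nonneg: "0 \<le> distortion"
  using C_nonneg \<rho>_less_1 by (simp add: distortion_def)

text \<open>
  At time \<open>j < n\<close> the two orbits still agree on \<open>N + (n - j)\<close> symbols, so the errors form a geometric
  series whose largest term is the one at time \<open>n - 1\<close>.
\<close>

lemma birkhoff_distortion:
  assumes "z \<in> \<Sigma>" "z' \<in> \<Sigma>" "agree (n + N) z z'"
  shows "\<bar>birkhoff n z - birkhoff n z'\<bar> \<le> distortion * \<rho> ^ N"
proof -
  have "\<bar>birkhoff n z - birkhoff n z'\<bar>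
      \<le> (\<Sum>j<n. \<bar>edge_potential ((left_shift ^^ j) z) - edge_potential ((left_shift ^^ j) z')\<bar>)"
    unfolding birkhoff_def sum_subtractf[symmetric] by (rule order_trans[OF sum_abs]) simp
  also have "\<dots> \<le> (\<Sum>j<n. C * \<rho> ^ (N + (n - Suc j)))"
  proof (rule sum_mono)
    fix j assume "j \<in> {..<n}"
    then have "agree (Suc (N + (n - Suc j)) + j) z z'"
      using assms(3) by (auto simp: agree_def)
    then show "\<bar>edge_potential ((left_shift ^^ j) z) - edge_potential ((left_shift ^^ j) z')\<bar> \<le> C * \<rho> ^ (N + (n - Suc j))"
      using assms by (intro edge_potential_variation agree_funpow_left_shift shift_space_funpow)
  qed
  also have "\<dots> = C * \<rho> ^ N * (\<Sum>j<n. \<rho> ^ j)"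
    unfolding sum.nat_diff_reindex[of "\<lambda>j. \<rho> ^ j" n, symmetric]
    by (simp only: power_add sum_distrib_left mult.assoc)
  also have "\<dots> \<le> C * \<rho> ^ N * (1 / (1 - \<rho>))"
    using C_nonneg \<rho>_pos \<rho>_less_1
    by (intro mult_left_mono) (auto simp: sum_gp_strict divide_right_mono)
  finally show ?thesis by (simp add: distortion_def)
qed


section \<open>Bounded Birkhoff sums and the sub-action\<close>

lemma integrable_continuous_bounded:
  assumes "prob_space \<mu>" "space \<mu> = \<Sigma>h" "sets \<mu> = sets (borel_of_top (hat_top r M lam))"
    and "continuous_map (hat_top r M lam) euclideanreal f" "\<And>p. p \<in> \<Sigma>h \<Longrightarrow> \<bar>f p\<bar> \<le> K"
  shows "integrable \<mu> f"
proof -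
  interpret prob_space \<mu> by fact
  have "f \<in> borel_measurable \<mu>"
    using continuous_map_real_borel_of_top[OF assms(4)] measurable_cong_sets[OF assms(3) refl] by blast
  then show ?thesis
    using assms(2,5) by (intro integrable_const_bound[of _ K] AE_I2) auto
qed

lemma integral_le_\<beta>:
  assumes "\<eta> \<in> holonomic r M lam"
  shows "(\<integral>p. A p \<partial>\<eta>) \<le> \<beta>"
  unfolding beta_def
proof (rule cSUP_upper[OF assms])
  obtain K where K: "\<And>p. p \<in> \<Sigma>h \<Longrightarrow> \<bar>A p\<bar> \<le> K" using A_bounded by auto
  have "(\<integral>p. A p \<partial>\<mu>) \<le> K" if \<mu>: "\<mu> \<in> holonomic r M lam" for \<mu>
  proof -
    have prob: "prob_space \<mu>" "space \<mu> = \<Sigma>h" "sets \<mu> = sets (borel_of_top (hat_top r M lam))"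
      using \<mu> by (auto simp: holonomic_def)
    then show ?thesis
      using K by (intro prob_space.integral_le_const integrable_continuous_bounded[OF prob continuous_map_A K] AE_I2)
        (use K prob(2) in \<open>auto simp: abs_le_iff\<close>)
  qed
  then show "bdd_above ((\<lambda>\<mu>. \<integral>p. A p \<partial>\<mu>) ` holonomic r M lam)"
    by (intro bdd_aboveI2)
qed

text \<open>
  The uniform measure \<open>\<eta>\<close> on the lifted periodic orbit is holonomic, because \<open>tau\<close> and
  \<open>snd\<close> both run through the orbit once, in cyclically shifted order. Its \<open>A\<close>-integral is
  therefore at most \<open>\<beta>\<close>, and it is the average of the potential up to the error \<open>\<delta>\<close> of the lift.
\<close>

lemma birkhoff_periodic_le_0:
  assumes z: "z \<in> \<Sigma>" and n: "1 \<le> n" and per: "(left_shift ^^ n) z = z"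
  shows "birkhoff n z \<le> 0"
proof (rule field_le_epsilon)
  fix e :: real assume "e > 0"
  define \<delta> where "\<delta> = e / n"
  have "\<delta> > 0" using \<open>e > 0\<close> n by (simp add: \<delta>_def)
  then obtain p where p: "\<And>j. p j \<in> \<Sigma>h" "\<And>j. tau (p j) = (left_shift ^^ j) z"
      "\<And>j. snd (p j) = (left_shift ^^ Suc j) z" "\<And>j. edge_potential ((left_shift ^^ j) z) - \<delta> < A (p j)"
    using orbit_lift[OF z] by metis
  define U where "U = uniform_count_measure {..<n}"
  define N where "N = borel_of_top (hat_top r M lam)"
  define \<eta> where "\<eta> = distr U N p"
  have pm: "p \<in> measurable U N"
    using p(1) by (auto simp: measurable_def U_def N_def space_borel_of_top topspace_hat_top
        space_uniform_count_measure sets_uniform_count_measure)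
  have ps: "prob_space \<eta>"
    unfolding \<eta>_def using n by (intro prob_space.prob_space_distr pm)
      (auto simp: U_def lessThan_empty_iff intro!: prob_space_uniform_count_measure)
  have int: "(\<integral>q. f q \<partial>\<eta>) = (\<Sum>j<n. f (p j)) / n"
    if "continuous_map (hat_top r M lam) euclideanreal f" for f
  proof -
    have "(\<integral>q. f q \<partial>\<eta>) = (\<integral>j. f (p j) \<partial>U)"
      unfolding \<eta>_def using continuous_map_real_borel_of_top[OF that]
      by (intro integral_distr pm) (simp add: N_def)
    then show ?thesis by (simp add: U_def integral_uniform_count_measure)
  qed
  have "(\<integral>q. f (tau q) \<partial>\<eta>) = (\<integral>q. f (snd q) \<partial>\<eta>)"
    if f: "continuous_map (shift_top r M lam) euclideanreal f" for f
  proof -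
    have "(\<Sum>j<n. f (tau (p j))) = (\<Sum>j<n. f (snd (p j)))"
    proof -
      have "(\<Sum>j<n. f ((left_shift ^^ Suc j) z) - f ((left_shift ^^ j) z)) = 0"
        using per by (subst sum_lessThan_telescope) simp
      then show ?thesis by (simp add: p sum_subtractf)
    qed
    then show ?thesis
      using int[OF continuous_map_compose[OF continuous_map_tau f]]
        int[OF continuous_map_compose[OF continuous_map_snd f]] by simp
  qed
  then have "\<eta> \<in> holonomic r M lam"
    using ps by (simp add: holonomic_def \<eta>_def N_def space_borel_of_top topspace_hat_top)
  then have "(\<Sum>j<n. A (p j)) / n \<le> \<beta>"
    using integral_le_\<beta> int[OF continuous_map_A] by metis
  then have "(\<Sum>j<n. A (p j)) \<le> n * \<beta>"
    using n by (simp add: divide_le_eq mult.commute)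
  moreover have "birkhoff n z \<le> (\<Sum>j<n. A (p j) + (\<delta> - \<beta>))"
    unfolding birkhoff_def using p(4) by (intro sum_mono) (simp add: less_imp_le algebra_simps)
  moreover have "n * \<delta> = e" using n by (simp add: \<delta>_def)
  moreover have "(\<Sum>j<n. A (p j) + (\<delta> - \<beta>)) = (\<Sum>j<n. A (p j)) + n * \<delta> - n * \<beta>"
    by (simp add: sum.distrib right_diff_distrib)
  ultimately show "birkhoff n z \<le> 0 + e" by linarith
qed

lemma birkhoff_add: "birkhoff (n + k) z = birkhoff n z + birkhoff k ((left_shift ^^ n) z)"
  unfolding birkhoff_def
  by (induction k) (auto simp: funpow_left_shift add_ac)

lemma birkhoff_Suc: "birkhoff (Suc n) z = birkhoff n z + (edge_potential ((left_shift ^^ n) z) - \<beta>)"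
  by (simp add: birkhoff_def)

text \<open>
  Close the segment to a periodic orbit: the periodic sum is at most \<open>0\<close>, following \<open>q\<close> instead of \<open>z\<close>
  costs at most \<open>distortion\<close>, and the at most \<open>L\<close> closing steps have bounded terms.
\<close>

lemma birkhoff_bounded_above: "\<exists>K. \<forall>n. \<forall>z\<in>\<Sigma>. birkhoff n z \<le> K"
proof -
  obtain L where L: "\<And>z n. z \<in> \<Sigma> \<Longrightarrow> 1 \<le> n \<Longrightarrow>
      \<exists>m q. n \<le> m \<and> m \<le> n + L \<and> q \<in> \<Sigma> \<and> (left_shift ^^ m) q = q \<and> agree n q z"
    using bounded_closing by blast
  obtain K where K: "0 \<le> K" "\<And>z. z \<in> \<Sigma> \<Longrightarrow> \<bar>edge_potential z\<bar> \<le> K" using edge_potential_bounded by blast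
  have "birkhoff n z \<le> distortion + L * (K + \<bar>\<beta>\<bar>)" if z: "z \<in> \<Sigma>" for n z
  proof (cases "n = 0")
    case True
    then show ?thesis using K distortion_nonneg by (simp add: birkhoff_def)
  next
    case False
    then obtain m q where m: "n \<le> m" "m \<le> n + L" and q: "q \<in> \<Sigma>" "(left_shift ^^ m) q = q" "agree n q z"
      using L[OF z, of n] by auto
    define k where "k = m - n"
    have k: "m = n + k" "k \<le> L" using m by (auto simp: k_def)
    have "birkhoff n z \<le> birkhoff n q + distortion"
      using birkhoff_distortion[of z q n 0] z q agree_sym[OF q(3)] by simp
    moreover have "birkhoff n q + birkhoff k ((left_shift ^^ n) q) \<le> 0"
      using birkhoff_periodic_le_0[OF q(1) _ q(2)] False m k by (simp add: birkhoff_add)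
    moreover have "- (L * (K + \<bar>\<beta>\<bar>)) \<le> birkhoff k ((left_shift ^^ n) q)"
    proof -
      have "(\<Sum>j<k. - (K + \<bar>\<beta>\<bar>)) \<le> birkhoff k ((left_shift ^^ n) q)"
        unfolding birkhoff_def
      proof (rule sum_mono)
        fix j
        have "\<bar>edge_potential ((left_shift ^^ j) ((left_shift ^^ n) q))\<bar> \<le> K"
          by (intro K shift_space_funpow q)
        then show "- (K + \<bar>\<beta>\<bar>) \<le> edge_potential ((left_shift ^^ j) ((left_shift ^^ n) q)) - \<beta>" by linarith
      qed
      moreover have "(\<Sum>j<k. - (K + \<bar>\<beta>\<bar>)) = - (k * (K + \<bar>\<beta>\<bar>))"
        unfolding sum_constant by (simp add: algebra_simps)
      moreover have "k * (K + \<bar>\<beta>\<bar>) \<le> L * (K + \<bar>\<beta>\<bar>)"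
        using k K by (intro mult_right_mono) auto
      ultimately show ?thesis by linarith
    qed
    ultimately show ?thesis by linarith
  qed
  then show ?thesis by blast
qed

text \<open>
  The supremum of what is collected by a path that starts at \<open>x\<close>. A path keeps its starting point as the tail
  of all later points, so the paths from two starting points can be compared symbol by symbol; this
  is why the starting point is fixed and not the end point, for which the comparison breaks down.
  The case \<open>n = 0\<close> makes the function nonnegative.
\<close>

definition gain :: "(nat \<Rightarrow> nat) \<Rightarrow> real" where
  "gain x = (SUP (n, z)\<in>{(n, z). z \<in> \<Sigma> \<and> (left_shift ^^ n) z = x}. birkhoff n z)"

lemma birkhoff_le_gain: "z \<in> \<Sigma> \<Longrightarrow> birkhoff n z \<le> gain ((left_shift ^^ n) z)"
proof -
  assume z: "z \<in> \<Sigma>"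
  obtain K where "\<forall>n. \<forall>z\<in>\<Sigma>. birkhoff n z \<le> K" using birkhoff_bounded_above by blast
  then have "bdd_above ((\<lambda>(n, z). birkhoff n z) ` {(n, w). w \<in> \<Sigma> \<and> (left_shift ^^ n) w = (left_shift ^^ n') z})" for n'
    by (intro bdd_aboveI2[of _ _ K]) auto
  then have "(\<lambda>(n, z). birkhoff n z) (n, z) \<le> gain ((left_shift ^^ n) z)"
    unfolding gain_def by (rule cSUP_upper[rotated]) (simp add: z)
  then show ?thesis by simp
qed

lemma gain_le:
  assumes "x \<in> \<Sigma>" "\<And>n z. z \<in> \<Sigma> \<Longrightarrow> (left_shift ^^ n) z = x \<Longrightarrow> birkhoff n z \<le> c"
  shows "gain x \<le> c"
  unfolding gain_def
proof (rule cSUP_least)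
  have "(0, x) \<in> {(n, z). z \<in> \<Sigma> \<and> (left_shift ^^ n) z = x}" using assms(1) by simp
  then show "{(n, z). z \<in> \<Sigma> \<and> (left_shift ^^ n) z = x} \<noteq> {}" by (metis empty_iff)
qed (use assms(2) in auto)

lemma gain_bounded: "\<exists>K. \<forall>x\<in>\<Sigma>. \<bar>gain x\<bar> \<le> K"
proof -
  obtain K where K: "\<And>n z. z \<in> \<Sigma> \<Longrightarrow> birkhoff n z \<le> K" using birkhoff_bounded_above by blast
  have "\<bar>gain x\<bar> \<le> K" if x: "x \<in> \<Sigma>" for x
    using gain_le[OF x, of K] K birkhoff_le_gain[OF x, of 0] by (simp add: birkhoff_def)
  then show ?thesis by blast
qed

text \<open>
  A path from \<open>z\<close> becomes a path from \<open>left_shift z\<close> when the step to \<open>z\<close> is put in front of it.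
\<close>

lemma gain_subaction:
  assumes "z \<in> \<Sigma>"
  shows "gain z + (edge_potential z - \<beta>) \<le> gain (left_shift z)"
proof -
  have "gain z \<le> gain (left_shift z) - (edge_potential z - \<beta>)"
  proof (rule gain_le[OF assms])
    fix n w assume w: "w \<in> \<Sigma>" "(left_shift ^^ n) w = z"
    then show "birkhoff n w \<le> gain (left_shift z) - (edge_potential z - \<beta>)"
      using birkhoff_le_gain[OF w(1), of "Suc n"] by (simp add: birkhoff_Suc)
  qed
  then show ?thesis by simp
qed

text \<open>
  The path of symbols used from \<open>x\<close> can also be used from \<open>x'\<close>, as their first symbols agree.
\<close>

lemma gain_variation:
  assumes "x \<in> \<Sigma>" "x' \<in> \<Sigma>" "agree N x x'" "1 \<le> N"
  shows "\<bar>gain x - gain x'\<bar> \<le> distortion * \<rho> ^ N"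
proof -
  have "gain x \<le> gain x' + distortion * \<rho> ^ N" if x: "x \<in> \<Sigma>" "x' \<in> \<Sigma>" "agree N x x'" for x x'
  proof (rule gain_le[OF x(1)])
    fix n z assume z: "z \<in> \<Sigma>" "(left_shift ^^ n) z = x"
    have "z n = x' 0"
      using x(3) z(2) assms(4) by (auto simp: funpow_left_shift agree_def)
    then have "splice n z x' \<in> \<Sigma>" using splice_in_shift_space[OF z(1) x(2)] by simp
    moreover have "agree (n + N) z (splice n z x')" using x(3) z(2) by (intro agree_splice) simp
    ultimately have "\<bar>birkhoff n z - birkhoff n (splice n z x')\<bar> \<le> distortion * \<rho> ^ N"
      using z(1) by (intro birkhoff_distortion)
    moreover have "birkhoff n (splice n z x') \<le> gain x'"
      using birkhoff_le_gain[OF \<open>splice n z x' \<in> \<Sigma>\<close>, of n] by (simp add: left_shift_splice)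
    ultimately show "birkhoff n z \<le> gain x' + distortion * \<rho> ^ N" by linarith
  qed
  from this[OF assms(1-3)] this[OF assms(2,1) agree_sym[OF assms(3)]] show ?thesis by linarith
qed

text \<open>
  Minus the slack in the sub-action inequality.
\<close>

definition defect :: "(nat \<Rightarrow> nat) \<Rightarrow> real" where
  "defect z = edge_potential z - \<beta> + gain z - gain (left_shift z)"

lemma defect_le_0: "z \<in> \<Sigma> \<Longrightarrow> defect z \<le> 0"
  using gain_subaction by (force simp: defect_def)

lemma defect_bounded: "\<exists>K. \<forall>z\<in>\<Sigma>. \<bar>defect z\<bar> \<le> K"
proof -
  obtain K K' where K: "\<And>z. z \<in> \<Sigma> \<Longrightarrow> \<bar>edge_potential z\<bar> \<le> K" "\<And>z. z \<in> \<Sigma> \<Longrightarrow> \<bar>gain z\<bar> \<le> K'"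
    using edge_potential_bounded gain_bounded by metis
  have "\<bar>defect z\<bar> \<le> K + \<bar>\<beta>\<bar> + 2 * K'" if "z \<in> \<Sigma>" for z
    using K(1)[OF that] K(2)[OF that] K(2)[OF shift_space_left_shift[OF that]] by (simp add: defect_def)
  then show ?thesis by blast
qed

lemma birkhoff_if_defect_0:
  assumes "\<And>j. defect ((left_shift ^^ j) z) = 0"
  shows "birkhoff n z = gain ((left_shift ^^ n) z) - gain z"
proof (induction n)
  case (Suc n)
  then show ?case using assms[of n] by (simp add: birkhoff_Suc defect_def)
qed (simp add: birkhoff_def)

lemma continuous_map_gain: "continuous_map (shift_top r M lam) euclideanreal gain"
proof (rule continuous_map_if_variation[of \<rho> 1 _ distortion])
  fix n x x' assume x: "x \<in> \<Sigma>" "x' \<in> \<Sigma>" "agree (n + 1) x x'"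
  have "distortion * \<rho> ^ (n + 1) \<le> distortion * \<rho> ^ n"
    using distortion_nonneg \<rho>_pos \<rho>_less_1 by (intro mult_left_mono power_decreasing) auto
  with gain_variation[OF x] show "\<bar>gain x - gain x'\<bar> \<le> distortion * \<rho> ^ n" by linarith
qed (use \<rho>_pos \<rho>_less_1 in auto)

lemma continuous_map_defect: "continuous_map (shift_top r M lam) euclideanreal defect"
proof (rule continuous_map_if_variation[of \<rho> 2 _ "C + 2 * distortion"])
  fix n x x' assume x: "x \<in> \<Sigma>" "x' \<in> \<Sigma>" "agree (n + 2) x x'"
  have le: "c * \<rho> ^ (n + k) \<le> c * \<rho> ^ n" if "0 \<le> c" for c k
    using that \<rho>_pos \<rho>_less_1 by (intro mult_left_mono power_decreasing) auto
  have "\<bar>edge_potential x - edge_potential x'\<bar> \<le> C * \<rho> ^ (n + 1)" using x by (intro edge_potential_variation) simp_all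
  moreover have "\<bar>gain x - gain x'\<bar> \<le> distortion * \<rho> ^ (n + 2)" using x by (intro gain_variation) simp_all
  moreover have "\<bar>gain (left_shift x) - gain (left_shift x')\<bar> \<le> distortion * \<rho> ^ (n + 1)"
    using x by (intro gain_variation shift_space_left_shift) (simp_all add: agree_def left_shift_def)
  moreover have "(C + 2 * distortion) * \<rho> ^ n = C * \<rho> ^ n + distortion * \<rho> ^ n + distortion * \<rho> ^ n"
    by (simp add: algebra_simps)
  ultimately show "\<bar>defect x - defect x'\<bar> \<le> (C + 2 * distortion) * \<rho> ^ n"
    using le[OF C_nonneg, of 1] le[OF distortion_nonneg, of 1] le[OF distortion_nonneg, of 2]
    unfolding defect_def by linarith
qed (use \<rho>_pos \<rho>_less_1 in auto)

section \<open>Maximizing measures and returning paths\<close>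

text \<open>
  Since \<open>A \<le> edge_potential \<circ> tau\<close>, the function \<open>defect \<circ> tau\<close> lies above
  \<open>A - \<beta> + gain \<circ> tau - gain \<circ> snd\<close>, whose integral is \<open>0\<close> because \<open>\<mu>\<close> is maximizing and holonomic. Holonomy,
  applied once more, moves the integral of \<open>defect\<close> from \<open>tau\<close> to \<open>snd\<close>; a function that is nowhere positive
  and has a nonnegative integral vanishes almost everywhere.
\<close>

lemma maximizing_AE_defect_0:
  assumes "maximizing r M lam A \<mu>"
  shows "AE z in distr \<mu> (borel_of_top (shift_top r M lam)) snd. defect z = 0"
proof -
  let ?N = "borel_of_top (shift_top r M lam)"
  have \<mu>: "prob_space \<mu>" "space \<mu> = \<Sigma>h" "sets \<mu> = sets (borel_of_top (hat_top r M lam))"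
    and hol: "\<And>f. continuous_map (shift_top r M lam) euclideanreal f \<Longrightarrow>
      (\<integral>p. f (tau p) \<partial>\<mu>) = (\<integral>p. f (snd p) \<partial>\<mu>)"
    and max: "(\<integral>p. A p \<partial>\<mu>) = \<beta>"
    using assms by (auto simp: maximizing_def holonomic_def)
  interpret prob_space \<mu> by fact
  have snd_m: "snd \<in> measurable \<mu> ?N"
    using continuous_map_borel_of_top[OF continuous_map_snd] measurable_cong_sets[OF \<mu>(3) refl] by blast
  obtain KA where KA: "\<And>p. p \<in> \<Sigma>h \<Longrightarrow> \<bar>A p\<bar> \<le> KA" using A_bounded by blast
  obtain Kv where Kv: "\<And>z. z \<in> \<Sigma> \<Longrightarrow> \<bar>gain z\<bar> \<le> Kv" using gain_bounded by blast
  obtain Kh where Kh: "\<And>z. z \<in> \<Sigma> \<Longrightarrow> \<bar>defect z\<bar> \<le> Kh" using defect_bounded by blast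
  have i_tau: "integrable \<mu> (\<lambda>p. f (tau p))" and i_snd: "integrable \<mu> (\<lambda>p. f (snd p))"
    if f: "continuous_map (shift_top r M lam) euclideanreal f" "\<And>z. z \<in> \<Sigma> \<Longrightarrow> \<bar>f z\<bar> \<le> K" for f K
    using integrable_continuous_bounded[OF \<mu> continuous_map_compose[OF continuous_map_tau f(1)], of K]
      integrable_continuous_bounded[OF \<mu> continuous_map_compose[OF continuous_map_snd f(1)], of K]
      f(2) tau_in_shift_space snd_in_shift_space by (auto simp: comp_def)
  note iA = integrable_continuous_bounded[OF \<mu> continuous_map_A KA]
  note iv = i_tau[OF continuous_map_gain Kv] i_snd[OF continuous_map_gain Kv]
  note ih = i_tau[OF continuous_map_defect Kh] i_snd[OF continuous_map_defect Kh]
  have "0 = (\<integral>p. A p - \<beta> + (gain (tau p) - gain (snd p)) \<partial>\<mu>)"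
    using iA iv hol[OF continuous_map_gain] max by (simp add: prob_space)
  also have "\<dots> \<le> (\<integral>p. defect (tau p) \<partial>\<mu>)"
  proof (rule integral_mono)
    show "integrable \<mu> (\<lambda>p. A p - \<beta> + (gain (tau p) - gain (snd p)))" using iA iv by simp
    fix p assume "p \<in> space \<mu>"
    then have "A p \<le> edge_potential (tau p)" using A_le_edge_potential \<mu>(2) by simp
    then show "A p - \<beta> + (gain (tau p) - gain (snd p)) \<le> defect (tau p)"
      by (simp add: defect_def left_shift_tau)
  qed (rule ih(1))
  also have "\<dots> = (\<integral>p. defect (snd p) \<partial>\<mu>)" by (rule hol[OF continuous_map_defect])
  finally have "0 \<le> (\<integral>p. defect (snd p) \<partial>\<mu>)" .
  moreover have nonpos: "AE p in \<mu>. 0 \<le> - defect (snd p)"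
    using defect_le_0 snd_in_shift_space \<mu>(2) by (intro AE_I2) auto
  moreover have "0 \<le> (\<integral>p. - defect (snd p) \<partial>\<mu>)"
    using nonpos by (rule integral_nonneg_AE)
  ultimately have "(\<integral>p. - defect (snd p) \<partial>\<mu>) = 0" by simp
  then have "AE p in \<mu>. - defect (snd p) = 0"
    using integral_nonneg_eq_0_iff_AE[OF _ nonpos] ih(2) by simp
  then have "AE p in \<mu>. defect (snd p) = 0" by simp
  moreover have "{z \<in> space ?N. defect z = 0} \<in> sets ?N"
    using continuous_map_real_borel_of_top[OF continuous_map_defect] by measurable
  ultimately show ?thesis by (simp add: AE_distr_iff[OF snd_m])
qed

lemma ex_returning_orbit:
  assumes \<nu>: "prob_space \<nu>" "sets \<nu> = sets (borel_of_top (shift_top r M lam))"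
    and f: "left_shift \<in> measurable \<nu> \<nu>" "distr \<nu> \<nu> left_shift = \<nu>"
    and h0: "AE z in \<nu>. defect z = 0"
    and U: "U \<in> sets \<nu>" "emeasure \<nu> U > 0"
  shows "\<exists>z n. 1 \<le> n \<and> z \<in> U \<and> (left_shift ^^ n) z \<in> U \<and> (\<forall>j. defect ((left_shift ^^ j) z) = 0)"
proof (rule ccontr)
  assume none: "\<not> ?thesis"
  interpret prob_space \<nu> by fact
  have "AE z in \<nu>. defect ((left_shift ^^ j) z) = 0" for j
  proof (rule AE_distrD[OF funpow_measurable[OF f(1)]])
    show "AE z in distr \<nu> \<nu> (left_shift ^^ j). defect z = 0" unfolding distr_funpow[OF f] by (rule h0)
  qed
  then have "AE z in \<nu>. \<forall>j. defect ((left_shift ^^ j) z) = 0" by (simp add: AE_all_countable)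
  with AE_returns[OF f U(1)] have "AE z in \<nu>. z \<notin> U"
    by eventually_elim (use none in auto)
  then have "U \<in> null_sets \<nu>" using U(1) by (simp add: AE_iff_null_sets)
  with U(2) show False by auto
qed

text \<open>
  The lift of the orbit of \<open>z\<close>, in reverse order, is a path from \<open>(left_shift ^^ n) z\<close> to \<open>z\<close>; the
  error \<open>\<delta>\<close> is distributed evenly over its \<open>n\<close> steps.
\<close>

lemma ex_path_near_orbit:
  assumes z: "z \<in> \<Sigma>" and n: "1 \<le> n" and \<delta>: "0 < \<delta>"
  shows "\<exists>ps. length ps = n \<and> set ps \<subseteq> \<Sigma>h \<and> snd (ps ! 0) = (left_shift ^^ n) z \<and>
    (\<forall>j. Suc j < length ps \<longrightarrow> snd (ps ! Suc j) = tau (ps ! j)) \<and> tau (last ps) = z \<and>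
    \<bar>(\<Sum>j<length ps. A (ps ! j) - \<beta>) - birkhoff n z\<bar> \<le> \<delta>"
proof -
  have "\<delta> / n > 0" using \<delta> n by simp
  then obtain p where p: "\<And>j. p j \<in> \<Sigma>h" "\<And>j. tau (p j) = (left_shift ^^ j) z"
      "\<And>j. snd (p j) = (left_shift ^^ Suc j) z" "\<And>j. edge_potential ((left_shift ^^ j) z) - \<delta> / n < A (p j)"
    using orbit_lift[OF z] by metis
  define ps where "ps = map (\<lambda>j. p (n - Suc j)) [0..<n]"
  have nth: "ps ! j = p (n - Suc j)" if "j < n" for j using that by (simp add: ps_def)
  have len: "length ps = n" by (simp add: ps_def)
  have "(\<Sum>j<n. A (ps ! j) - \<beta>) = (\<Sum>j<n. A (p (n - Suc j)) - \<beta>)"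
    by (intro sum.cong) (auto simp: nth)
  also have "\<dots> = (\<Sum>j<n. A (p j) - \<beta>)"
    by (rule sum.nat_diff_reindex)
  finally have "\<bar>(\<Sum>j<n. A (ps ! j) - \<beta>) - birkhoff n z\<bar> = \<bar>\<Sum>j<n. A (p j) - edge_potential ((left_shift ^^ j) z)\<bar>"
    by (simp add: birkhoff_def sum_subtractf)
  also have "\<dots> \<le> (\<Sum>j<n. \<bar>A (p j) - edge_potential ((left_shift ^^ j) z)\<bar>)" by (rule sum_abs)
  also have "\<dots> \<le> (\<Sum>j<n. \<delta> / n)"
  proof (rule sum_mono)
    fix j
    show "\<bar>A (p j) - edge_potential ((left_shift ^^ j) z)\<bar> \<le> \<delta> / n"
      using A_le_edge_potential[OF p(1), of j] p(2)[of j] p(4)[of j] by (simp add: abs_le_iff)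
  qed
  also have "\<dots> = \<delta>" using n by simp
  finally have "\<bar>(\<Sum>j<length ps. A (ps ! j) - \<beta>) - birkhoff n z\<bar> \<le> \<delta>" by (simp only: len)
  moreover have "set ps \<subseteq> \<Sigma>h" using p(1) by (auto simp: ps_def)
  moreover have "snd (ps ! 0) = (left_shift ^^ n) z" using n p(3)[of "n - 1"] by (simp add: nth)
  moreover have "\<forall>j. Suc j < length ps \<longrightarrow> snd (ps ! Suc j) = tau (ps ! j)"
  proof (intro allI impI)
    fix j assume "Suc j < length ps"
    then have "Suc (n - Suc (Suc j)) = n - Suc j" "Suc j < n" by (auto simp: len)
    then show "snd (ps ! Suc j) = tau (ps ! j)" using p(3)[of "n - Suc (Suc j)"]
      by (simp only: nth p(2) Suc_lessD)
  qed
  moreover have "tau (last ps) = z"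
    using n p(2)[of 0] by (simp add: last_conv_nth len nth flip: length_greater_0_conv)
  ultimately show ?thesis using len by blast
qed

text \<open>
  The path found has two sources of error beyond the choice of pasts: the replacement of the tail of \<open>z\<close> by \<open>x\<close>,
  and the difference of \<open>gain\<close> at the two ends. Each is at most \<open>distortion * \<rho> ^ N\<close> for the cylinder length
  \<open>N\<close>, which explains the factor \<open>2\<close> in the choice of \<open>N\<close>.
\<close>

lemma support_subset_nonwandering:
  assumes max: "maximizing r M lam A \<mu>"
    and erg: "left_shift \<in> measurable \<nu> \<nu>" "distr \<nu> \<nu> left_shift = \<nu>"
    and \<nu>: "\<nu> = distr \<mu> (borel_of_top (shift_top r M lam)) snd"
  shows "snd ` top_support (hat_top r M lam) \<mu> \<subseteq> nonwandering r M lam A"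
proof
  fix x assume "x \<in> snd ` top_support (hat_top r M lam) \<mu>"
  then obtain q where q: "q \<in> \<Sigma>h" "snd q = x"
    and supp: "\<And>U. openin (hat_top r M lam) U \<Longrightarrow> q \<in> U \<Longrightarrow> emeasure \<mu> U > 0"
    by (auto simp: top_support_def topspace_hat_top)
  have x: "x \<in> \<Sigma>" using q snd_in_shift_space by blast
  have \<mu>: "prob_space \<mu>" "space \<mu> = \<Sigma>h" "sets \<mu> = sets (borel_of_top (hat_top r M lam))"
    using max by (auto simp: maximizing_def holonomic_def)
  have snd_m: "snd \<in> measurable \<mu> (borel_of_top (shift_top r M lam))"
    using continuous_map_borel_of_top[OF continuous_map_snd] measurable_cong_sets[OF \<mu>(3) refl] by blast
  have "prob_space \<nu>" unfolding \<nu> by (rule prob_space.prob_space_distr[OF \<mu>(1) snd_m])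
  have sets_\<nu>: "sets \<nu> = sets (borel_of_top (shift_top r M lam))" by (simp add: \<nu>)
  have "\<exists>ps\<in>paths r M lam x x \<epsilon>. \<bar>\<Sum>j<length ps. A (ps ! j) - \<beta>\<bar> < \<epsilon>" if "\<epsilon> > 0" for \<epsilon>
  proof -
    have lim: "(\<lambda>N. 2 * distortion * \<rho> ^ N) \<longlonglongrightarrow> 2 * distortion * 0" "(\<lambda>N. lam ^ N) \<longlonglongrightarrow> 0"
      using \<rho>_pos \<rho>_less_1 lam_pos lam_less_1
      by (intro tendsto_mult_left LIMSEQ_realpow_zero; simp)+
    have "\<forall>\<^sub>F N in sequentially. 2 * distortion * \<rho> ^ N < \<epsilon> / 2" "\<forall>\<^sub>F N in sequentially. lam ^ N < \<epsilon>"
      by (rule order_tendstoD(2)[OF lim(1)] order_tendstoD(2)[OF lim(2)]; use \<open>\<epsilon> > 0\<close> in simp)+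
    then have "\<forall>\<^sub>F N in sequentially. 2 * distortion * \<rho> ^ N < \<epsilon> / 2 \<and> lam ^ N < \<epsilon> \<and> 1 \<le> N"
      using eventually_ge_at_top[of 1] by eventually_elim auto
    then obtain N where N: "2 * distortion * \<rho> ^ N < \<epsilon> / 2" "lam ^ N < \<epsilon>" "1 \<le> N"
      by (auto simp: eventually_sequentially)
    define U where "U = {z \<in> \<Sigma>. agree N x z}"
    have oU: "openin (shift_top r M lam) U" unfolding U_def by (rule openin_cylinder)
    then have "openin (hat_top r M lam) {p \<in> \<Sigma>h. snd p \<in> U}"
      using openin_continuous_map_preimage[OF continuous_map_snd] topspace_hat_top by simp
    then have "emeasure \<mu> {p \<in> \<Sigma>h. snd p \<in> U} > 0"
      by (rule supp) (use q x in \<open>auto simp: U_def agree_def\<close>)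
    moreover have "{p \<in> \<Sigma>h. snd p \<in> U} = snd -` U \<inter> space \<mu>" using \<mu>(2) by auto
    ultimately have "emeasure \<nu> U > 0"
      unfolding \<nu> using oU by (simp add: emeasure_distr[OF snd_m] openin_in_borel_of_top)
    moreover have "AE z in \<nu>. defect z = 0"
      unfolding \<nu> by (rule maximizing_AE_defect_0[OF max])
    moreover have "U \<in> sets \<nu>" using oU sets_\<nu> by (simp add: openin_in_borel_of_top)
    ultimately obtain z n where n: "1 \<le> n" and zU: "z \<in> U" "(left_shift ^^ n) z \<in> U"
      and h0: "\<And>j. defect ((left_shift ^^ j) z) = 0"
      using ex_returning_orbit[OF \<open>prob_space \<nu>\<close> sets_\<nu> erg] by metis
    \<comment> \<open>The path has to start exactly at \<open>x\<close>, not merely near it.\<close>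
    define w where "w = splice n z x"
    have z: "z \<in> \<Sigma>" "agree N x z" "(left_shift ^^ n) z \<in> \<Sigma>" "agree N x ((left_shift ^^ n) z)"
      using zU by (auto simp: U_def)
    have "z n = x 0" using z(4) N(3) by (auto simp: agree_def funpow_left_shift)
    then have w: "w \<in> \<Sigma>" unfolding w_def by (rule splice_in_shift_space[OF z(1) x])
    have zw: "agree (n + N) z w"
      unfolding w_def by (rule agree_splice[OF agree_sym[OF z(4)]])
    obtain ps where ps: "length ps = n" "set ps \<subseteq> \<Sigma>h" "snd (ps ! 0) = (left_shift ^^ n) w"
        "\<forall>j. Suc j < length ps \<longrightarrow> snd (ps ! Suc j) = tau (ps ! j)" "tau (last ps) = w"
        "\<bar>(\<Sum>j<length ps. A (ps ! j) - \<beta>) - birkhoff n w\<bar> \<le> \<epsilon> / 2"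
      using ex_path_near_orbit[OF w n, of "\<epsilon> / 2"] \<open>\<epsilon> > 0\<close> by auto
    have "agree N w x"
      using agree_trans[OF z(2) agree_mono[OF zw]] by (auto intro: agree_sym)
    then have "seq_dist lam w x < \<epsilon>"
      using seq_dist_le_if_agree[OF lam_pos lam_less_1] N(2) by (meson le_less_trans)
    then have "ps \<in> paths r M lam x x \<epsilon>"
      using ps n by (auto simp: paths_def w_def left_shift_splice)
    moreover have "\<bar>birkhoff n w\<bar> \<le> 2 * distortion * \<rho> ^ N"
    proof -
      have "\<bar>birkhoff n z - birkhoff n w\<bar> \<le> distortion * \<rho> ^ N" by (rule birkhoff_distortion[OF z(1) w zw])
      \<comment> \<open>Both ends of the orbit segment lie in \<open>U\<close>, so the telescoped sum is small.\<close>
      moreover have "\<bar>gain ((left_shift ^^ n) z) - gain z\<bar> \<le> distortion * \<rho> ^ N"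
        using agree_trans[OF agree_sym[OF z(4)] z(2)] by (rule gain_variation[OF z(3,1) _ N(3)])
      ultimately show ?thesis using birkhoff_if_defect_0[OF h0, of n] by linarith
    qed
    ultimately show ?thesis using ps(6) N(1) by (intro bexI[of _ ps]) linarith+
  qed
  with x show "x \<in> nonwandering r M lam A" by (auto simp: nonwandering_def)
qed

end

theorem proposition18:
  fixes r :: nat and M :: "nat \<Rightarrow> nat \<Rightarrow> nat" and lam \<theta> :: real
    and A :: "(nat \<Rightarrow> nat) \<times> (nat \<Rightarrow> nat) \<Rightarrow> real"
    and \<mu> :: "((nat \<Rightarrow> nat) \<times> (nat \<Rightarrow> nat)) measure"
  assumes "\<And>i j. i \<in> {1..r} \<Longrightarrow> j \<in> {1..r} \<Longrightarrow> M i j \<in> {0, 1}"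
    and "shift_space r M \<noteq> {}"
    and "0 < lam" and "lam < 1"
    and "topologically_transitive (shift_top r M lam) left_shift"
    and "0 < \<theta>"
    and "holder_on \<theta> (hat_space r M) (hat_dist lam) A"
    and "maximizing r M lam A \<mu>"
    and "ergodic left_shift (distr \<mu> (borel_of_top (shift_top r M lam)) snd)"
  shows "snd ` top_support (hat_top r M lam) \<mu> \<subseteq> nonwandering r M lam A"
proof -
  from assms(7) obtain C where C: "\<And>p q. p \<in> hat_space r M \<Longrightarrow> q \<in> hat_space r M \<Longrightarrow>
      \<bar>A p - A q\<bar> \<le> C * hat_dist lam p q powr \<theta>"
    unfolding holder_on_def by blast
  have "C * t powr \<theta> \<le> max C 0 * t powr \<theta>" for t
    by (intro mult_right_mono) auto
  with C have "\<bar>A p - A q\<bar> \<le> max C 0 * hat_dist lam p q powr \<theta>"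
    if "p \<in> hat_space r M" "q \<in> hat_space r M" for p q
    using that by (meson order_trans)
  then have "holder_potential r M lam A \<theta> (max C 0)"
    using assms(3-6) by unfold_locales simp_all
  then show ?thesis
    using assms(8,9) unfolding ergodic_def
    by (intro holder_potential.support_subset_nonwandering[OF _ _ _ _ refl]) auto
qed

end
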